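(* Let $\Omega\subset\mathbb{R}^n$ be an open set and let $V$ be a $d$-varifold in $\Omega$ with bounded variations. Then ($\|V\|$-almost everywhere) $$\sum_qA^{V,\perp}_{q\cdot q}=H^{V,\perp}\quad\text{and}\quad\sum_qA^{V,\perp}_{\cdot qq}=0,$$ where $H^{V,\perp}=(I-c^V)H^V$.
   Context: Fix integers $1\le d\le n$; $e_1,\dots,e_n$ is the canonical basis of $\mathbb{R}^n$. $G_{d,n}$ is the Grassmannian of $d$-dimensional linear subspaces of $\mathbb{R}^n$; each $S\in G_{d,n}$ is identified with the matrix $(S_{jk})$ of the orthogonal projection onto $S$. A $d$-varifold $V$ in $\Omega$ is a non-negative Radon measure on $\Omega\times G_{d,n}$; its mass is $\|V\|(B)=V(B\times G_{d,n})$, and it disintegrates as $V=\|V\|\otimes\nu_x$ with probability measures $\nu_x$ on $G_{d,n}$ for $\|V\|$-a.e. $x$. For $\varphi\in C^1$, $\nabla^S\varphi=S\nabla\varphi$. The $G$-linear variations are the distributions $\delta_{ijk}V(\varphi)=\int_{\Omega\times G_{d,n}}S_{jk}\,\nabla^S\varphi(y)\cdot e_i\,dV(y,S)$, $\varphi\in C_c^1(\Omega)$. $V$ has (locally) bounded variations if all $\delta_{ijk}V$ are (signed) Radon measures; then $\beta^V_{ijk}\in L^1_{loc}(\|V\|)$ is defined by $\delta_{ijk}V=-\beta^V_{ijk}\|V\|+(\delta_{ijk}V)_s$ with $(\delta_{ijk}V)_s$ singular with respect to $\|V\|$. Put $c^V(x)=\int_{G_{d,n}}S\,d\nu_x(S)$.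 A dot in an index position denotes the vector obtained by letting this index vary: $\sum_q\beta_{q\cdot q}$ has $i$-th component $\sum_q\beta_{qiq}$, and $\sum_qA_{\cdot qq}$ has $i$-th component $\sum_qA_{iqq}$. Define $$\beta^{V,\perp}_{ijk}(x)=\beta^V_{ijk}(x)-c^V_{jk}(x)\Bigl(c^V(x)\sum_q\beta^V_{q\cdot q}(x)\Bigr)_i,$$ and let the orthogonal weak second fundamental form $A^{V,\perp}=(A^{V,\perp}_{ijk})$ be, for $\|V\|$-a.e. $x$, the unique solution of the linear system $A^{V,\perp}_{ijk}(x)+c^V_{jk}(x)\sum_qA^{V,\perp}_{qiq}(x)=\beta^{V,\perp}_{ijk}(x)$, $i,j,k=1,\dots,n$. The first variation is the vector-valued distribution $\delta V(\varphi)=\int_{\Omega\times G_{d,n}}\nabla^S\varphi(y)\,dV(y,S)$, $\varphi\in C^1_c(\Omega)$; it is a vector Radon measure when $V$ has bounded variations, and the generalized mean curvature $H^V$ is defined by $\delta V=-H^V\|V\|+\delta V_s$ with $\delta V_s$ singular with respect to $\|V\|$. *)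

theory Defs
  imports "HOL-Probability.Probability"
begin

text \<open>Members of the Grassmannian are represented by the matrices of the orthogonal projections
  onto them; the topology is the one induced by the space of matrices.\<close>

definition ortho_proj_onto :: "(real^'n) set \<Rightarrow> real^'n^'n \<Rightarrow> bool" where
  "ortho_proj_onto S P \<longleftrightarrow> (\<forall>x. P *v x \<in> S \<and> x - P *v x \<in> orthogonal_comp S)"

definition grassmannian :: "nat \<Rightarrow> (real^'n^'n) set" where
  "grassmannian d = {P. \<exists>S. subspace S \<and> dim S = d \<and> ortho_proj_onto S P}"

text \<open>Non-negative Radon measures on \<open>X\<close>. For \<open>X\<close> locally compact and second countable, the only
  case used below, every Borel measure that is finite on compact sets is regular.\<close>

definition radon_on :: "'a::topological_space set \<Rightarrow> 'a measure \<Rightarrow> bool" where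
  "radon_on X M \<longleftrightarrow> sets M = sets (restrict_space borel X) \<and>
     (\<forall>K. compact K \<and> K \<subseteq> X \<longrightarrow> emeasure M K < \<infinity>)"

definition varifold :: "nat \<Rightarrow> (real^'n) set \<Rightarrow> ((real^'n) \<times> (real^'n^'n)) measure \<Rightarrow> bool" where
  "varifold d \<Omega> V \<longleftrightarrow> radon_on (\<Omega> \<times> grassmannian d) V"

definition mass :: "(real^'n) set \<Rightarrow> ((real^'n) \<times> (real^'n^'n)) measure \<Rightarrow> (real^'n) measure" where
  "mass \<Omega> V = distr V (restrict_space borel \<Omega>) fst"

lemma emeasure_mass:
  fixes V :: "((real^'n) \<times> (real^'n^'n)) measure"
  assumes "varifold d \<Omega> V" "B \<in> sets (restrict_space borel \<Omega>)"
  shows "emeasure (mass \<Omega> V) B = emeasure V (B \<times> grassmannian d)"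
proof -
  have sV: "sets V = sets (restrict_space borel (\<Omega> \<times> grassmannian d))"
    using assms(1) by (simp add: varifold_def radon_on_def)
  have sp: "space V = \<Omega> \<times> grassmannian d"
    using sets_eq_imp_space_eq[OF sV] by (simp add: space_restrict_space)
  have "(fst :: (real^'n) \<times> (real^'n^'n) \<Rightarrow> real^'n) \<in> borel_measurable borel"
    by (intro borel_measurable_continuous_onI continuous_intros)
  then have "(fst :: (real^'n) \<times> (real^'n^'n) \<Rightarrow> real^'n)
      \<in> restrict_space borel (\<Omega> \<times> grassmannian d) \<rightarrow>\<^sub>M restrict_space borel \<Omega>"
    by (intro measurable_restrict_space3) auto
  then have m: "fst \<in> V \<rightarrow>\<^sub>M restrict_space borel \<Omega>"
    by (simp cong: measurable_cong_sets add: sV)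
  have "B \<subseteq> \<Omega>"
    using sets.sets_into_space[OF assms(2)] by (simp add: space_restrict_space)
  then have "fst -` B \<inter> space V = B \<times> grassmannian d" by (auto simp: sp)
  then show ?thesis
    using m assms(2) by (simp add: mass_def emeasure_distr)
qed

text \<open>\<open>V = \<parallel>V\<parallel> \<otimes> \<nu>\<close> for a measurable family of probability measures on the Grassmannian.\<close>

definition disintegration ::
  "nat \<Rightarrow> (real^'n) set \<Rightarrow> ((real^'n) \<times> (real^'n^'n)) measure \<Rightarrow> (real^'n \<Rightarrow> (real^'n^'n) measure) \<Rightarrow> bool" where
  "disintegration d \<Omega> V \<nu> \<longleftrightarrow>
     \<nu> \<in> mass \<Omega> V \<rightarrow>\<^sub>M prob_algebra (restrict_space borel (grassmannian d)) \<and>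
     (\<forall>B\<in>sets V. emeasure V B = (\<integral>\<^sup>+x. emeasure (\<nu> x) (Pair x -` B) \<partial>mass \<Omega> V))"

definition mean_proj :: "(real^'n \<Rightarrow> (real^'n^'n) measure) \<Rightarrow> real^'n \<Rightarrow> real^'n^'n" where
  "mean_proj \<nu> x = (\<integral>S. S \<partial>\<nu> x)"

definition grad :: "(real^'n \<Rightarrow> real) \<Rightarrow> real^'n \<Rightarrow> real^'n" where
  "grad \<phi> x = (THE D. GDERIV \<phi> x :> D)"

text \<open>\<open>C\<^sup>1\<close> functions with compact support in \<open>\<Omega>\<close>, extended by zero to the whole space.\<close>

definition C1c :: "(real^'n) set \<Rightarrow> (real^'n \<Rightarrow> real) set" where
  "C1c \<Omega> = {\<phi>. (\<forall>x. \<phi> differentiable (at x)) \<and> continuous_on UNIV (grad \<phi>) \<and>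
     compact (closure {x. \<phi> x \<noteq> 0}) \<and> closure {x. \<phi> x \<noteq> 0} \<subseteq> \<Omega>}"

definition linear_variation ::
  "((real^'n) \<times> (real^'n^'n)) measure \<Rightarrow> 'n \<Rightarrow> 'n \<Rightarrow> 'n \<Rightarrow> (real^'n \<Rightarrow> real) \<Rightarrow> real" where
  "linear_variation V i j k \<phi> = (\<integral>(y, S). S $ j $ k * ((S *v grad \<phi> y) \<bullet> axis i 1) \<partial>V)"

definition first_variation ::
  "((real^'n) \<times> (real^'n^'n)) measure \<Rightarrow> (real^'n \<Rightarrow> real) \<Rightarrow> real^'n" where
  "first_variation V \<phi> = (\<integral>(y, S). S *v grad \<phi> y \<partial>V)"

text \<open>A signed Radon measure need not have finite total variation, so it is given as a formal
  difference of two non-negative Radon measures, acting on compactly supported functions.\<close>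

definition signed_radon :: "(real^'n) set \<Rightarrow> ((real^'n \<Rightarrow> real) \<Rightarrow> real) \<Rightarrow> bool" where
  "signed_radon \<Omega> T \<longleftrightarrow> (\<exists>\<sigma> \<tau>. radon_on \<Omega> \<sigma> \<and> radon_on \<Omega> \<tau> \<and>
     (\<forall>\<phi>\<in>C1c \<Omega>. T \<phi> = (\<integral>x. \<phi> x \<partial>\<sigma>) - (\<integral>x. \<phi> x \<partial>\<tau>)))"

definition bounded_variations ::
  "(real^'n) set \<Rightarrow> ((real^'n) \<times> (real^'n^'n)) measure \<Rightarrow> bool" where
  "bounded_variations \<Omega> V \<longleftrightarrow> (\<forall>i j k. signed_radon \<Omega> (linear_variation V i j k))"

definition mutually_singular :: "'a measure \<Rightarrow> 'a measure \<Rightarrow> bool" where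
  "mutually_singular M N \<longleftrightarrow>
     (\<exists>A\<in>sets M \<inter> sets N. emeasure M A = 0 \<and> emeasure N (space N - A) = 0)"

definition loc_integrable :: "(real^'n) set \<Rightarrow> (real^'n) measure \<Rightarrow> (real^'n \<Rightarrow> real) \<Rightarrow> bool" where
  "loc_integrable \<Omega> \<mu> f \<longleftrightarrow> f \<in> borel_measurable \<mu> \<and>
     (\<forall>K. compact K \<and> K \<subseteq> \<Omega> \<longrightarrow> set_integrable \<mu> K f)"

text \<open>\<open>T = f \<mu> + T\<^sub>s\<close> with \<open>f \<in> L\<^sup>1\<^sub>l\<^sub>o\<^sub>c(\<mu>)\<close> and \<open>T\<^sub>s = \<sigma> - \<tau>\<close> a signed Radon measure
  singular with respect to \<open>\<mu>\<close>.\<close>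

definition lebesgue_density ::
  "(real^'n) set \<Rightarrow> (real^'n) measure \<Rightarrow> ((real^'n \<Rightarrow> real) \<Rightarrow> real) \<Rightarrow> (real^'n \<Rightarrow> real) \<Rightarrow> bool" where
  "lebesgue_density \<Omega> \<mu> T f \<longleftrightarrow> loc_integrable \<Omega> \<mu> f \<and>
     (\<exists>\<sigma> \<tau>. radon_on \<Omega> \<sigma> \<and> radon_on \<Omega> \<tau> \<and> mutually_singular \<mu> \<sigma> \<and> mutually_singular \<mu> \<tau> \<and>
       (\<forall>\<phi>\<in>C1c \<Omega>. T \<phi> = (\<integral>x. \<phi> x * f x \<partial>\<mu>) + ((\<integral>x. \<phi> x \<partial>\<sigma>) - (\<integral>x. \<phi> x \<partial>\<tau>))))"

text \<open>The densities below are unique up to \<open>\<parallel>V\<parallel>\<close>-null sets, hence given as predicates.\<close>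

definition variation_density ::
  "(real^'n) set \<Rightarrow> ((real^'n) \<times> (real^'n^'n)) measure \<Rightarrow> ('n \<Rightarrow> 'n \<Rightarrow> 'n \<Rightarrow> real^'n \<Rightarrow> real) \<Rightarrow> bool" where
  "variation_density \<Omega> V \<beta> \<longleftrightarrow>
     (\<forall>i j k. lebesgue_density \<Omega> (mass \<Omega> V) (linear_variation V i j k) (\<lambda>x. - \<beta> i j k x))"

text \<open>A vector-valued measure is Radon, respectively singular, iff all its components are.\<close>

definition generalized_mean_curvature ::
  "(real^'n) set \<Rightarrow> ((real^'n) \<times> (real^'n^'n)) measure \<Rightarrow> (real^'n \<Rightarrow> real^'n) \<Rightarrow> bool" where
  "generalized_mean_curvature \<Omega> V H \<longleftrightarrow>
     (\<forall>i. lebesgue_density \<Omega> (mass \<Omega> V) (\<lambda>\<phi>. first_variation V \<phi> $ i) (\<lambda>x. - H x $ i))"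

definition orth_density ::
  "(real^'n \<Rightarrow> real^'n^'n) \<Rightarrow> ('n \<Rightarrow> 'n \<Rightarrow> 'n \<Rightarrow> real^'n \<Rightarrow> real) \<Rightarrow> 'n \<Rightarrow> 'n \<Rightarrow> 'n \<Rightarrow> real^'n \<Rightarrow> real" where
  "orth_density c \<beta> i j k x =
     \<beta> i j k x - c x $ j $ k * (c x *v (\<chi> i'. \<Sum>q\<in>UNIV. \<beta> q i' q x)) $ i"

text \<open>The orthogonal weak second fundamental form at \<open>x\<close>, indexed by \<open>i\<close>, \<open>j\<close>, \<open>k\<close>.\<close>

definition orth_wsff ::
  "(real^'n \<Rightarrow> real^'n^'n) \<Rightarrow> ('n \<Rightarrow> 'n \<Rightarrow> 'n \<Rightarrow> real^'n \<Rightarrow> real) \<Rightarrow> real^'n \<Rightarrow> 'n \<Rightarrow> 'n \<Rightarrow> 'n \<Rightarrow> real" where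
  "orth_wsff c \<beta> x = (THE A. \<forall>i j k.
     A i j k + c x $ j $ k * (\<Sum>q\<in>UNIV. A q i q) = orth_density c \<beta> i j k x)"

end

theory Submission
  imports Defs
begin

text \<open>
  Integrating \<open>S\<^sup>2 = S\<close> and \<open>tr S = d\<close> against the varifold expresses the first variation through the
  linear variations: \<open>\<Sum>\<^sub>q \<delta>\<^sub>q\<^sub>i\<^sub>q V = (\<delta> V)\<^sub>i\<close> and \<open>\<Sum>\<^sub>q \<delta>\<^sub>i\<^sub>q\<^sub>q V = d (\<delta> V)\<^sub>i\<close> as distributions
  (\<open>first_variation_trace_outer\<close>, \<open>first_variation_trace_inner\<close>). Since the absolutely continuous part
  of a signed Radon measure is determined by its values on \<open>C\<^sup>1\<close> test functions
  (\<open>lebesgue_density_lincomb_eq_0\<close>), the same relations hold between densities almost everywhere: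
  \<open>\<Sum>\<^sub>q \<beta>\<^sub>q\<^sub>i\<^sub>q = H\<^sub>i\<close> and \<open>\<Sum>\<^sub>q \<beta>\<^sub>i\<^sub>q\<^sub>q = d H\<^sub>i\<close>.

  The rest is linear algebra at one point (\<open>orth_wsff_traces\<close>). The mean \<open>c\<close> of projections of rank \<open>d\<close>
  has trace \<open>d\<close> and is positive semidefinite, so that \<open>I + c\<close> is invertible. Tracing the linear system
  over its first and third indices gives \<open>(I + c) u = (I - c\<^sup>2) H\<close> for \<open>u\<^sub>i = \<Sum>\<^sub>q A\<^sub>q\<^sub>i\<^sub>q\<close>, that is
  \<open>u = (I - c) H\<close>. Tracing over the last two gives
  \<open>\<Sum>\<^sub>q A\<^sub>i\<^sub>q\<^sub>q = d H\<^sub>i - d (c H)\<^sub>i - d u\<^sub>i = 0\<close>.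

  The analytic work lies in the uniqueness of densities. It needs \<open>C\<^sup>1\<close> cutoffs converging to the
  indicator of a compact set (\<open>C1c_approx_indicator\<close>), inner regularity of Radon measures
  (\<open>radon_on_null_if_compact_null\<close>), and compactness of the Grassmannian (\<open>compact_grassmannian\<close>), by
  which the mass of a varifold is a Radon measure.
\<close>

section \<open>The Grassmannian as a set of matrices\<close>

text \<open>Expanding \<open>P x\<close> in an orthonormal basis \<open>B\<close> of \<open>S\<close> writes \<open>P\<close> as the sum of the rank-one
  matrices \<open>b b\<^sup>T\<close>, each of trace \<open>|b|\<^sup>2 = 1\<close>; this is why the trace is the dimension.\<close>

lemma ortho_proj_onto_imp_projector:
  fixes P :: "real^'n^'n"
  assumes S: "subspace S" and P: "ortho_proj_onto S P"
  shows "transpose P = P" and "P ** P = P" and "trace P = real (dim S)"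
proof -
  have PS: "P *v x \<in> S" for x
    using P by (simp add: ortho_proj_onto_def)
  have orth: "y \<bullet> (x - P *v x) = 0" if "y \<in> S" for x y
    using P that by (auto simp: ortho_proj_onto_def orthogonal_comp_def orthogonal_def)
  have fixed: "y \<bullet> (P *v x) = y \<bullet> x" if "y \<in> S" for x y
    using orth[OF that, of x] by (simp add: inner_diff_right)
  have sym: "(P *v x) \<bullet> y = x \<bullet> (P *v y)" for x y
    using fixed[OF PS, of x y] fixed[OF PS, of y x] by (simp add: inner_commute)
  show "transpose P = P"
  proof -
    have "P $ j $ i = P $ i $ j" for i j
      using sym[of "axis i 1" "axis j 1"]
      by (simp add: inner_axis inner_axis' matrix_vector_mul_component matrix_vector_mult_basis column_def)
    then show ?thesis by (simp add: transpose_def vec_eq_iff)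
  qed
  have "P *v (P *v x) = P *v x" for x
  proof -
    have "(P *v x - P *v (P *v x)) \<bullet> (P *v x - P *v (P *v x)) = 0"
      by (rule orth) (intro subspace_diff[OF S] PS)
    then show ?thesis by simp
  qed
  then show "P ** P = P"
    by (simp add: matrix_eq matrix_vector_mul_assoc)
  obtain B where B: "B \<subseteq> S" "pairwise orthogonal B" "\<And>x. x \<in> B \<Longrightarrow> norm x = 1"
      "independent B" "card B = dim S" "span B = S"
    using orthonormal_basis_subspace[OF S] by metis
  have finB: "finite B"
    using B(4) by (rule independent_imp_finite)
  have ex: "P *v x = (\<Sum>b\<in>B. (b \<bullet> x) *\<^sub>R b)" for x
  proof -
    have "P *v x = (\<Sum>b\<in>B. (b \<bullet> (P *v x)) *\<^sub>R b)"
      using orthonormal_basis_expand[OF B(2,3) _ finB, of "P *v x"] PS B(6)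
      by (simp add: inner_commute)
    also have "\<dots> = (\<Sum>b\<in>B. (b \<bullet> x) *\<^sub>R b)"
      using fixed B(1) by (intro sum.cong) auto
    finally show ?thesis .
  qed
  have "P $ i $ i = (\<Sum>b\<in>B. b $ i * b $ i)" for i
  proof -
    have "P $ i $ i = (P *v axis i 1) $ i"
      by (simp add: matrix_vector_mult_basis column_def)
    then show ?thesis by (simp add: ex inner_axis)
  qed
  then have "trace P = (\<Sum>b\<in>B. b \<bullet> b)"
    by (simp add: trace_def inner_vec_def sum.swap[of _ _ B])
  also have "\<dots> = (\<Sum>b\<in>B. 1)"
    using B(3) by (intro sum.cong) (auto simp: norm_eq_1)
  finally show "trace P = real (dim S)" using B(5) by simp
qed

text \<open>The Grassmannian is cut out by polynomial equations in the matrix entries. The trace equation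
  records the dimension: a symmetric idempotent projects onto its range, whose dimension is the
  trace.\<close>

lemma grassmannian_iff_projector:
  fixes P :: "real^'n^'n"
  shows "P \<in> grassmannian d \<longleftrightarrow> transpose P = P \<and> P ** P = P \<and> trace P = real d"
proof
  assume "P \<in> grassmannian d"
  then show "transpose P = P \<and> P ** P = P \<and> trace P = real d"
    unfolding grassmannian_def using ortho_proj_onto_imp_projector by blast
next
  assume P: "transpose P = P \<and> P ** P = P \<and> trace P = real d"
  define S where "S = range ((*v) P)"
  have S: "subspace S"
    unfolding S_def by (intro linear_subspace_image) auto
  have idem: "P *v (P *v x) = P *v x" for x
    using P by (simp add: matrix_vector_mul_assoc)
  have "(P *v y) \<bullet> (x - P *v x) = 0" for x y
    using P idem dot_lmul_matrix[of y P "x - P *v x"]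
    by (metis diff_self inner_zero_right matrix_vector_mult_diff_distrib transpose_matrix_vector)
  then have "ortho_proj_onto S P"
    by (auto simp: ortho_proj_onto_def S_def orthogonal_comp_def orthogonal_def)
  moreover from this S P have "dim S = d"
    using ortho_proj_onto_imp_projector(3) by fastforce
  ultimately show "P \<in> grassmannian d"
    using S by (auto simp: grassmannian_def)
qed

lemma projector_quadratic_form:
  fixes P :: "real^'n^'n"
  assumes "P \<in> grassmannian d"
  shows "x \<bullet> (P *v x) = (P *v x) \<bullet> (P *v x)"
proof -
  have "transpose P = P" "P ** P = P"
    using assms by (auto simp: grassmannian_iff_projector)
  then show ?thesis
    using dot_lmul_matrix[of x P "P *v x"]
    by (metis matrix_vector_mul_assoc transpose_matrix_vector)
qed

text \<open>Closedness comes from the polynomial equations and boundedness from projections being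
  contractions. Compactness turns the local finiteness of a varifold into that of its mass and makes
  the test integrands integrable.\<close>

lemma compact_grassmannian: "compact (grassmannian d :: (real^'n^'n) set)"
proof -
  have "closed (grassmannian d :: (real^'n^'n) set)"
  proof -
    have eq: "grassmannian d = {P::real^'n^'n. transpose P = P} \<inter> {P. P ** P = P} \<inter> {P. trace P = real d}"
      by (auto simp: grassmannian_iff_projector)
    show ?thesis unfolding eq
      unfolding transpose_def matrix_matrix_mult_def trace_def
      by (intro closed_Int closed_Collect_eq continuous_intros)
  qed
  moreover have "bounded (grassmannian d :: (real^'n^'n) set)"
  proof (rule boundedI)
    fix P :: "real^'n^'n" assume P: "P \<in> grassmannian d"
    have "norm (P *v axis j 1) \<le> 1" for j
    proof -
      have "norm (P *v axis j 1) * norm (P *v axis j 1) = axis j 1 \<bullet> (P *v axis j 1)"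
        using projector_quadratic_form[OF P, of "axis j 1"] by (simp add: dot_square_norm power2_eq_square)
      also have "\<dots> \<le> norm (axis j (1::real)) * norm (P *v axis j 1)"
        by (rule norm_cauchy_schwarz)
      finally have "norm (P *v axis j 1) * norm (P *v axis j 1) \<le> 1 * norm (P *v axis j 1)"
        by simp
      then show ?thesis
        unfolding mult_le_cancel_right using norm_ge_zero[of "P *v axis j 1"] by linarith
    qed
    then have comp: "\<bar>P $ i $ j\<bar> \<le> 1" for i j
      using component_le_norm_cart[of "P *v axis j 1" i]
      by (metis matrix_vector_mult_basis column_def order_trans vec_lambda_beta)
    have "norm P \<le> (\<Sum>i\<in>UNIV. norm (P $ i))"
      unfolding norm_vec_def[of P] by (rule L2_set_le_sum) simp
    also have "\<dots> \<le> (\<Sum>i\<in>(UNIV::'n set). \<Sum>j\<in>(UNIV::'n set). 1)"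
      using comp by (intro sum_mono order.trans[OF norm_le_l1_cart]) auto
    finally show "norm P \<le> (\<Sum>i\<in>(UNIV::'n set). \<Sum>j\<in>(UNIV::'n set). 1)" .
  qed
  ultimately show ?thesis by (simp add: compact_eq_bounded_closed)
qed

section \<open>Pointwise linear algebra\<close>

text \<open>Both properties hold for every projection in the Grassmannian and are preserved by averaging,
  unlike idempotence, which is in general lost.\<close>

lemma
  fixes \<nu> :: "real^'n \<Rightarrow> (real^'n^'n) measure"
  assumes \<nu>: "\<nu> x \<in> space (prob_algebra (restrict_space borel (grassmannian d)))"
  shows trace_mean_proj: "trace (mean_proj \<nu> x) = real d"
    and mean_proj_psd: "0 \<le> v \<bullet> (mean_proj \<nu> x *v v)"
proof -
  have sets: "sets (\<nu> x) = sets (restrict_space borel (grassmannian d))"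
    and "prob_space (\<nu> x)"
    using \<nu> by (auto simp: space_prob_algebra)
  then interpret prob_space "\<nu> x" by simp
  have sp: "space (\<nu> x) = grassmannian d"
    using sets_eq_imp_space_eq[OF sets] by (simp add: space_restrict_space)
  obtain C where C: "\<And>S. S \<in> (grassmannian d :: (real^'n^'n) set) \<Longrightarrow> norm S \<le> C"
    using compact_imp_bounded[OF compact_grassmannian] unfolding bounded_iff by blast
  have meas: "(\<lambda>S. S) \<in> borel_measurable (\<nu> x)"
    by (subst measurable_cong_sets[OF sets refl]) (simp add: measurable_restrict_space1)
  have int: "integrable (\<nu> x) (\<lambda>S. S)"
    using C sp by (intro integrable_const_bound[where B=C] meas AE_I2) auto
  have entry: "bounded_linear (\<lambda>S::real^'n^'n. S $ i $ j)" for i j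
    by (rule bounded_linear_compose[OF bounded_linear_vec_nth bounded_linear_vec_nth])
  have "trace (mean_proj \<nu> x) = (\<integral>S. trace S \<partial>\<nu> x)"
    unfolding mean_proj_def
    unfolding trace_def
    by (rule integral_bounded_linear[symmetric, OF _ int]) (intro bounded_linear_sum entry)
  also have "\<dots> = (\<integral>S. real d \<partial>\<nu> x)"
    by (rule Bochner_Integration.integral_cong) (auto simp: sp grassmannian_iff_projector)
  finally show "trace (mean_proj \<nu> x) = real d" by (simp add: prob_space)
  have lin: "bounded_linear (\<lambda>S::real^'n^'n. v \<bullet> (S *v v))"
    unfolding inner_vec_def matrix_vector_mult_def vec_lambda_beta inner_real_def
    by (intro bounded_linear_sum bounded_linear_const_mult bounded_linear_mult_const entry)
  have "v \<bullet> (mean_proj \<nu> x *v v) = (\<integral>S. v \<bullet> (S *v v) \<partial>\<nu> x)"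
    unfolding mean_proj_def by (rule integral_bounded_linear[symmetric, OF lin int])
  also have "\<dots> \<ge> 0"
    by (intro Bochner_Integration.integral_nonneg) (auto simp: sp projector_quadratic_form)
  finally show "0 \<le> v \<bullet> (mean_proj \<nu> x *v v)" .
qed

text \<open>Taking the trace over the first and third indices of the defining system gives
  \<open>(I + c) u = (I - c\<^sup>2) h = (I + c) (I - c) h\<close> for \<open>u\<^sub>i = \<Sum>\<^sub>q A\<^sub>q\<^sub>i\<^sub>q\<close>. As \<open>c\<close> is positive semidefinite,
  \<open>I + c\<close> is injective, hence \<open>u = (I - c) h\<close>; then the system itself determines \<open>A\<close>. In the trace
  over the last two indices, \<open>tr c\<close> factors out and multiplies \<open>h - c h - (I - c) h = 0\<close>.\<close>

lemma orth_wsff_traces: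
  fixes c :: "real^'n \<Rightarrow> real^'n^'n" and h :: "real^'n"
  assumes psd: "\<And>v. 0 \<le> v \<bullet> (c x *v v)"
    and h: "\<And>i. (\<Sum>q\<in>UNIV. \<beta> q i q x) = h $ i"
    and tr: "\<And>i. (\<Sum>q\<in>UNIV. \<beta> i q q x) = trace (c x) * h $ i"
  shows "(\<chi> i. \<Sum>q\<in>UNIV. orth_wsff c \<beta> x q i q) = (mat 1 - c x) *v h"
    and "(\<chi> i. \<Sum>q\<in>UNIV. orth_wsff c \<beta> x i q q) = 0"
proof -
  \<comment> \<open>\<open>w\<close> is the anticipated value of the trace, \<open>A0\<close> the solution of the system that it forces.\<close>
  define w where "w = (mat 1 - c x) *v h"
  define A0 where "A0 i j k = orth_density c \<beta> i j k x - c x $ j $ k * w $ i" for i j k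
  have w: "w = h - c x *v h"
    by (simp add: w_def matrix_vector_mult_diff_rdistrib)
  have dens: "orth_density c \<beta> i j k x = \<beta> i j k x - c x $ j $ k * (c x *v h) $ i" for i j k
    by (simp add: orth_density_def h)
  have dens_trace: "(\<Sum>q\<in>UNIV. orth_density c \<beta> q i q x) = h $ i - (c x *v (c x *v h)) $ i" for i
  proof -
    have "(c x *v (c x *v h)) $ i = (\<Sum>q\<in>UNIV. c x $ i $ q * (c x *v h) $ q)"
      by (subst matrix_vector_mult_def) simp
    then show ?thesis by (simp add: dens sum_subtractf h)
  qed
  have trace_h: "(\<Sum>q\<in>UNIV. orth_density c \<beta> q i q x) = w $ i + (c x *v w) $ i" for i
    by (simp add: dens_trace w matrix_vector_mult_diff_distrib)
  have cw: "(\<Sum>q\<in>UNIV. c x $ i $ q * u $ q) = (c x *v u) $ i" for i u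
    by (simp add: matrix_vector_mult_def)
  have tr0: "(\<Sum>q\<in>UNIV. A0 q i q) = w $ i" for i
    by (simp add: A0_def sum_subtractf trace_h cw)
  have sys: "A0 i j k + c x $ j $ k * (\<Sum>q\<in>UNIV. A0 q i q) = orth_density c \<beta> i j k x" for i j k
    by (simp add: tr0) (simp add: A0_def)
  have "orth_wsff c \<beta> x = A0"
    unfolding orth_wsff_def
  proof (rule the_equality)
    show "\<forall>i j k. A0 i j k + c x $ j $ k * (\<Sum>q\<in>UNIV. A0 q i q) = orth_density c \<beta> i j k x"
      using sys by blast
  next
    fix A assume A: "\<forall>i j k. A i j k + c x $ j $ k * (\<Sum>q\<in>UNIV. A q i q) = orth_density c \<beta> i j k x"
    define u :: "real^'n" where "u = (\<chi> i. \<Sum>q\<in>UNIV. A q i q)"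
    have A': "A i j k + c x $ j $ k * u $ i = orth_density c \<beta> i j k x" for i j k
      using A by (simp add: u_def)
    have "u $ i + (c x *v u) $ i = w $ i + (c x *v w) $ i" for i
    proof -
      have "u $ i + (c x *v u) $ i = (\<Sum>q\<in>UNIV. A q i q + c x $ i $ q * u $ q)"
        by (simp add: sum.distrib cw) (simp add: u_def)
      then show ?thesis by (simp add: A' trace_h)
    qed
    then have "(u - w) + c x *v (u - w) = 0"
      by (simp add: vec_eq_iff matrix_vector_mult_diff_distrib algebra_simps)
    then have "(u - w) \<bullet> (u - w) + (u - w) \<bullet> (c x *v (u - w)) = 0"
      by (metis inner_add_right inner_zero_right)
    then have "(u - w) \<bullet> (u - w) = 0"
      using psd[of "u - w"] inner_ge_zero[of "u - w"] by linarith
    then have "u = w" by simp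
    then show "A = A0"
      using A' by (intro ext) (simp add: A0_def eq_diff_eq)
  qed
  moreover have "(\<Sum>q\<in>UNIV. A0 i q q) = 0" for i
  proof -
    have "(\<Sum>q\<in>UNIV. A0 i q q)
        = (\<Sum>q\<in>UNIV. \<beta> i q q x) - trace (c x) * (c x *v h) $ i - trace (c x) * w $ i"
      by (simp add: A0_def dens sum_subtractf trace_def sum_distrib_right)
    then show ?thesis by (simp add: tr w algebra_simps)
  qed
  ultimately show "(\<chi> i. \<Sum>q\<in>UNIV. orth_wsff c \<beta> x q i q) = (mat 1 - c x) *v h"
    and "(\<chi> i. \<Sum>q\<in>UNIV. orth_wsff c \<beta> x i q q) = 0"
    using tr0 by (auto simp: w_def vec_eq_iff)
qed

section \<open>Continuously differentiable cutoffs\<close>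

lemma grad_eqI:
  assumes "GDERIV f x :> D"
  shows "grad f x = D"
  unfolding grad_def
proof (rule the_equality[of "\<lambda>D. GDERIV f x :> D", OF assms])
  fix D' assume "GDERIV f x :> D'"
  then have "(\<lambda>h. h \<bullet> D') = (\<lambda>h. h \<bullet> D)"
    using assms unfolding gderiv_def by (rule has_derivative_unique)
  then show "D' = D"
    by (metis vector_eq_ldot)
qed

text \<open>The gradient enters as an explicit witness because \<^const>\<open>grad\<close> is a definite description,
  which says nothing before a gradient has been exhibited.\<close>

definition C1 :: "('a::real_inner \<Rightarrow> real) \<Rightarrow> bool" where
  "C1 f \<longleftrightarrow> (\<exists>g. continuous_on UNIV g \<and> (\<forall>x. GDERIV f x :> g x))"

lemma C1_continuous: "C1 f \<Longrightarrow> continuous_on UNIV f"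
  unfolding C1_def gderiv_def
  by (metis continuous_at_imp_continuous_on has_derivative_continuous)

lemma C1_const: "C1 (\<lambda>x. k)"
  unfolding C1_def by (intro exI[of _ "\<lambda>x. 0"]) (auto intro: GDERIV_const)

lemma C1_diff:
  assumes "C1 f" "C1 g"
  shows "C1 (\<lambda>x. f x - g x)"
proof -
  obtain f' g' where "continuous_on UNIV f'" "\<And>x. GDERIV f x :> f' x"
      "continuous_on UNIV g'" "\<And>x. GDERIV g x :> g' x"
    using assms unfolding C1_def by blast
  then show ?thesis
    unfolding C1_def
    by (intro exI[of _ "\<lambda>x. f' x - g' x"]) (auto intro: GDERIV_diff continuous_on_diff)
qed

lemma C1_add:
  assumes "C1 f" "C1 g"
  shows "C1 (\<lambda>x. f x + g x)"
proof -
  obtain f' g' where "continuous_on UNIV f'" "\<And>x. GDERIV f x :> f' x"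
      "continuous_on UNIV g'" "\<And>x. GDERIV g x :> g' x"
    using assms unfolding C1_def by blast
  then show ?thesis
    unfolding C1_def
    by (intro exI[of _ "\<lambda>x. f' x + g' x"]) (auto intro: GDERIV_add continuous_on_add)
qed

lemma C1_sum: "finite I \<Longrightarrow> (\<And>i. i \<in> I \<Longrightarrow> C1 (f i)) \<Longrightarrow> C1 (\<lambda>x. \<Sum>i\<in>I. f i x)"
  by (induction I rule: finite_induct) (auto intro: C1_const C1_add)

lemma C1_compose:
  assumes f: "C1 f" and g': "continuous_on UNIV g'" and g: "\<And>t. DERIV g t :> g' t"
  shows "C1 (\<lambda>x. g (f x))"
proof -
  obtain f' where f': "continuous_on UNIV f'" "\<And>x. GDERIV f x :> f' x"
    using f unfolding C1_def by blast
  have "continuous_on UNIV (\<lambda>x. g' (f x))"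
    using continuous_on_compose2[OF g' C1_continuous[OF f]] by simp
  then have "continuous_on UNIV (\<lambda>x. g' (f x) *\<^sub>R f' x)"
    using f'(1) by (intro continuous_intros)
  moreover have "GDERIV (\<lambda>x. g (f x)) x :> g' (f x) *\<^sub>R f' x" for x
    by (rule GDERIV_DERIV_compose[OF f'(2) g])
  ultimately show ?thesis unfolding C1_def by blast
qed

lemma C1_sq_dist: "C1 (\<lambda>x. (x - c) \<bullet> (x - c))"
  unfolding C1_def gderiv_def
  by (intro exI[of _ "\<lambda>x. 2 *\<^sub>R (x - c)"] conjI allI)
     (auto intro!: continuous_intros derivative_eq_intros simp: inner_commute)

lemma C1c_I:
  fixes \<phi> :: "real^'n \<Rightarrow> real"
  assumes "C1 \<phi>" and L: "compact L" "L \<subseteq> \<Omega>" and zero: "\<And>x. x \<notin> L \<Longrightarrow> \<phi> x = 0"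
  shows "\<phi> \<in> C1c \<Omega>"
proof -
  obtain g where g: "continuous_on UNIV g" "\<And>x. GDERIV \<phi> x :> g x"
    using \<open>C1 \<phi>\<close> unfolding C1_def by blast
  then have "grad \<phi> = g" by (intro ext grad_eqI)
  moreover have "\<phi> differentiable (at x)" for x
    using g(2) unfolding gderiv_def by (blast intro: differentiableI)
  moreover have sub: "closure {x. \<phi> x \<noteq> 0} \<subseteq> L"
    using zero compact_imp_closed[OF L(1)] by (intro closure_minimal) auto
  moreover have "compact (closure {x. \<phi> x \<noteq> 0})"
    using compact_Int_closed[OF L(1) closed_closure, of "{x. \<phi> x \<noteq> 0}"] sub
    by (simp add: Int_absorb1)
  ultimately show ?thesis
    using g(1) L(2) by (auto simp: C1c_def)
qed

lemma C1c_continuous: "\<phi> \<in> C1c \<Omega> \<Longrightarrow> continuous_on UNIV \<phi>"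
  unfolding C1c_def by (auto intro: differentiable_imp_continuous_on simp: differentiable_on_def)

text \<open>Off the support the function vanishes in a neighbourhood, hence so does its gradient; this
  makes integrands that are linear in the gradient compactly supported.\<close>

lemma grad_eq_0_off_support:
  assumes "x \<notin> closure {x. \<phi> x \<noteq> 0}"
  shows "grad \<phi> x = 0"
proof (rule grad_eqI)
  have "GDERIV (\<lambda>x. 0) x :> 0" by (rule GDERIV_const)
  then show "GDERIV \<phi> x :> 0"
    unfolding gderiv_def
    by (rule has_derivative_transform_within_open[where s="- closure {x. \<phi> x \<noteq> 0}"])
       (use assms closure_subset[of "{x. \<phi> x \<noteq> 0}"] in auto)
qed

text \<open>The squared positive part, a \<open>C\<^sup>1\<close> function of a real variable that vanishes exactly
  on a half-line. It serves for localised bumps and for the truncation at height \<open>1\<close>.\<close>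

definition pos_sq :: "real \<Rightarrow> real" where
  "pos_sq t = (max 0 t)\<^sup>2"

lemma DERIV_pos_sq: "DERIV pos_sq t :> 2 * max 0 t"
proof -
  have "((\<lambda>s. (pos_sq s - pos_sq t) / (s - t) - 2 * max 0 t) \<longlongrightarrow> 0) (at t)"
  proof (rule Lim_null_comparison)
    show "((\<lambda>s. \<bar>s - t\<bar>) \<longlongrightarrow> 0) (at t)"
      by (rule tendsto_eq_intros refl | simp)+
    have "norm ((pos_sq s - pos_sq t) / (s - t) - 2 * max 0 t) \<le> \<bar>s - t\<bar>" if "s \<noteq> t" for s
    proof -
      \<comment> \<open>\<open>D\<close> is the error of the tangent at \<open>t\<close>: nonnegative by convexity, at most quadratic.\<close>
      define D where "D = (pos_sq s - pos_sq t) - 2 * max 0 t * (s - t)"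
      consider "0 \<le> s" "0 \<le> t" | "s \<le> 0" "0 \<le> t" | "0 \<le> s" "t \<le> 0" | "s \<le> 0" "t \<le> 0"
        by linarith
      then have "0 \<le> D \<and> D \<le> (s - t) * (s - t)"
      proof cases
        case 1
        then have "D = (s - t) * (s - t)"
          by (simp add: D_def pos_sq_def power2_eq_square algebra_simps)
        then show ?thesis by simp
      next
        case 2
        then have "D = t * t - 2 * (s * t)"
          by (auto simp: D_def pos_sq_def power2_eq_square algebra_simps max_def)
        moreover have "s * t \<le> 0" "0 \<le> s * s" "0 \<le> t * t" using 2 by (auto simp: mult_nonpos_nonneg)
        moreover have "(s - t) * (s - t) = s * s - 2 * (s * t) + t * t" by (simp add: algebra_simps)
        ultimately show ?thesis by linarith
      next
        case 3
        then have "D = s * s"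
          by (auto simp: D_def pos_sq_def power2_eq_square max_def)
        moreover have "s * t \<le> 0" "0 \<le> s * s" "0 \<le> t * t" using 3 by (auto simp: mult_nonneg_nonpos)
        moreover have "(s - t) * (s - t) = s * s - 2 * (s * t) + t * t" by (simp add: algebra_simps)
        ultimately show ?thesis by linarith
      next
        case 4
        then show ?thesis by (simp add: D_def pos_sq_def max_def)
      qed
      then have "\<bar>D\<bar> \<le> \<bar>s - t\<bar> * \<bar>s - t\<bar>"
        by simp
      moreover have "(pos_sq s - pos_sq t) / (s - t) - 2 * max 0 t
          = D / (s - t)"
        using that by (simp add: D_def diff_divide_distrib)
      ultimately show ?thesis
        using that by (simp add: abs_divide divide_le_eq)
    qed
    then show "\<forall>\<^sub>F s in at t. norm ((pos_sq s - pos_sq t) / (s - t) - 2 * max 0 t) \<le> \<bar>s - t\<bar>"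
      by (simp add: eventually_at_filter)
  qed
  then show ?thesis
    unfolding has_field_derivative_iff by (rule LIM_zero_cancel)
qed

lemma C1_pos_sq: "C1 f \<Longrightarrow> C1 (\<lambda>x. pos_sq (f x))"
  by (rule C1_compose[OF _ _ DERIV_pos_sq]) (auto intro!: continuous_intros)

text \<open>Finitely many balls of radius \<open>r\<close> centred in \<open>K\<close> cover \<open>K\<close>. The sum of \<open>C\<^sup>1\<close> bumps that are positive
  exactly on these balls is bounded below on \<open>K\<close> by some \<open>\<delta> > 0\<close>, so that truncating it at
  height \<open>\<delta>\<close> in a \<open>C\<^sup>1\<close> way gives the cutoff.\<close>

lemma C1_cutoff_near_compact:
  fixes K :: "'a::real_inner set"
  assumes K: "compact K" and r: "r > 0"
  obtains \<phi> where "C1 \<phi>" "\<And>x. 0 \<le> \<phi> x" "\<And>x. \<phi> x \<le> 1" "\<And>x. x \<in> K \<Longrightarrow> \<phi> x = 1"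
    "\<And>x. \<phi> x \<noteq> 0 \<Longrightarrow> \<exists>c\<in>K. dist x c < r"
proof -
  have "K \<subseteq> (\<Union>c\<in>K. ball c r)" using r by auto
  then obtain F where F: "F \<subseteq> K" "finite F" "K \<subseteq> (\<Union>c\<in>F. ball c r)"
    using compactE_image[OF K, of K "\<lambda>c. ball c r"] by auto
  define \<psi> where "\<psi> x = (\<Sum>c\<in>F. pos_sq (r\<^sup>2 - (x - c) \<bullet> (x - c)))" for x
  have C1\<psi>: "C1 \<psi>"
    unfolding \<psi>_def by (intro C1_sum F C1_pos_sq C1_diff C1_const C1_sq_dist)
  have bump: "pos_sq (r\<^sup>2 - (x - c) \<bullet> (x - c)) > 0 \<longleftrightarrow> dist x c < r" for x c :: 'a
  proof -
    have "(x - c) \<bullet> (x - c) < r\<^sup>2 \<longleftrightarrow> dist x c < r"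
      using r by (metis abs_le_square_iff abs_norm_cancel abs_of_pos dist_norm dot_square_norm not_le)
    then show ?thesis by (auto simp: pos_sq_def max_def)
  qed
  have bump0: "pos_sq t \<ge> 0" for t by (simp add: pos_sq_def)
  have pos: "\<psi> x > 0" if "x \<in> K" for x
  proof -
    obtain c where "c \<in> F" "dist x c < r" using F(3) \<open>x \<in> K\<close> by (force simp: dist_commute)
    then show ?thesis
      unfolding \<psi>_def using F(2) bump bump0 by (intro sum_pos2) auto
  qed
  obtain \<delta> where \<delta>: "\<delta> > 0" "\<And>x. x \<in> K \<Longrightarrow> \<delta> \<le> \<psi> x"
  proof (cases "K = {}")
    case True then show ?thesis using that[of 1] by auto
  next
    case False
    obtain y where "y \<in> K" "\<And>x. x \<in> K \<Longrightarrow> \<psi> y \<le> \<psi> x"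
      using continuous_attains_inf[OF K False continuous_on_subset[OF C1_continuous[OF C1\<psi>]]] by auto
    then show ?thesis using that pos by blast
  qed
  \<comment> \<open>\<open>t \<mapsto> 1 - pos_sq (1 - pos_sq t)\<close> is \<open>C\<^sup>1\<close> with values in \<open>[0, 1]\<close>, equal to \<open>0\<close> for \<open>t \<le> 0\<close>
     and to \<open>1\<close> for \<open>t \<ge> 1\<close>.\<close>
  define \<phi> where "\<phi> x = 1 - pos_sq (1 - pos_sq (\<psi> x / \<delta>))" for x
  show thesis
  proof (rule that)
    have "C1 (\<lambda>x. \<psi> x / \<delta>)"
      by (rule C1_compose[OF C1\<psi>, where g'="\<lambda>_. 1 / \<delta>"])
         (auto intro!: continuous_intros derivative_eq_intros simp: \<delta>(1)[THEN less_imp_neq, symmetric])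
    then show "C1 \<phi>"
      unfolding \<phi>_def by (intro C1_diff C1_const C1_pos_sq)
    show "0 \<le> \<phi> x" for x
    proof -
      have "max 0 (1 - pos_sq (\<psi> x / \<delta>)) \<le> 1" using bump0 by simp
      then have "pos_sq (1 - pos_sq (\<psi> x / \<delta>)) \<le> 1"
        by (subst pos_sq_def) (intro power_le_one, auto)
      then show ?thesis by (simp add: \<phi>_def)
    qed
    show "\<phi> x \<le> 1" for x
      using bump0 by (simp add: \<phi>_def)
    show "\<phi> x = 1" if "x \<in> K" for x
    proof -
      have "1 \<le> \<psi> x / \<delta>" using \<delta> that by simp
      then have "1 \<le> pos_sq (\<psi> x / \<delta>)" by (simp add: pos_sq_def one_le_power)
      then show ?thesis by (simp add: \<phi>_def pos_sq_def)
    qed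
    show "\<exists>c\<in>K. dist x c < r" if "\<phi> x \<noteq> 0" for x
    proof (rule ccontr)
      assume "\<not> (\<exists>c\<in>K. dist x c < r)"
      then have "\<psi> x = 0"
        unfolding \<psi>_def using F(1) bump bump0
        by (intro sum.neutral ballI) (metis less_eq_real_def subsetD)
      then show False using that by (simp add: \<phi>_def pos_sq_def)
    qed
  qed
qed

text \<open>The common compact set \<open>L\<close> provides the dominating function when the limit is taken under an
  integral against a locally integrable density.\<close>

lemma C1c_approx_indicator:
  fixes \<Omega> :: "(real^'n) set"
  assumes \<Omega>: "open \<Omega>" and K: "compact K" "K \<subseteq> \<Omega>"
  obtains \<phi> L where "compact L" "L \<subseteq> \<Omega>" "\<And>n::nat. \<phi> n \<in> C1c \<Omega>"
    "\<And>n x. \<bar>\<phi> n x\<bar> \<le> indicator L x" "\<And>x. (\<lambda>n. \<phi> n x) \<longlonglongrightarrow> indicator K x"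
proof (cases "K = {}")
  case True
  show thesis
    by (rule that[of "{}" "\<lambda>n x. 0"]) (auto simp: True intro: C1c_I[OF C1_const, of "{}"])
next
  case False
  obtain \<epsilon> where \<epsilon>: "\<epsilon> > 0" "{x. infdist x K \<le> \<epsilon>} \<subseteq> \<Omega>"
    using compact_in_open_separated[OF False K(1) \<Omega> K(2)] by blast
  define L where "L = {x. infdist x K \<le> \<epsilon>}"
  have L: "compact L" unfolding L_def by (rule compact_infdist_le[OF False K(1) \<epsilon>(1)])
  have "\<exists>\<phi>. C1 \<phi> \<and> (\<forall>x. 0 \<le> \<phi> x) \<and> (\<forall>x. \<phi> x \<le> 1) \<and> (\<forall>x\<in>K. \<phi> x = 1)
      \<and> (\<forall>x. \<phi> x \<noteq> 0 \<longrightarrow> (\<exists>c\<in>K. dist x c < \<epsilon> / Suc n))" for n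
    by (rule C1_cutoff_near_compact[OF K(1), of "\<epsilon> / Suc n"]) (use \<epsilon> in auto)
  then obtain \<phi> where \<phi>: "\<And>n. C1 (\<phi> n)" "\<And>n x. 0 \<le> \<phi> n x" "\<And>n x. \<phi> n x \<le> 1"
      "\<And>n x. x \<in> K \<Longrightarrow> \<phi> n x = 1"
      and near: "\<And>n x. \<phi> n x \<noteq> 0 \<Longrightarrow> \<exists>c\<in>K. dist x c < \<epsilon> / Suc n"
    by metis
  have supp: "infdist x K \<le> \<epsilon> / Suc n" if "\<phi> n x \<noteq> 0" for n x
    using near[OF that] infdist_le[of _ K x] by force
  have "\<epsilon> / Suc n \<le> \<epsilon>" for n
    using \<epsilon>(1) by (simp add: divide_le_eq)
  then have suppL: "x \<in> L" if "\<phi> n x \<noteq> 0" for n x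
    using supp[OF that] order_trans unfolding L_def by blast
  show thesis
  proof (rule that[of L \<phi>])
    show "compact L" "L \<subseteq> \<Omega>" using L \<epsilon>(2) by (auto simp: L_def)
    then show "\<phi> n \<in> C1c \<Omega>" for n
      using \<phi>(1) suppL by (intro C1c_I[of _ L]) auto
    show "\<bar>\<phi> n x\<bar> \<le> indicator L x" for n x
      using \<phi>(2,3)[of n x] suppL[of n x] by (auto simp: indicator_def)
    show "(\<lambda>n. \<phi> n x) \<longlonglongrightarrow> indicator K x" for x
    proof (cases "x \<in> K")
      case True
      then show ?thesis using \<phi>(4) by simp
    next
      case notK: False
      then have "infdist x K > 0"
        using in_closed_iff_infdist_zero[OF compact_imp_closed[OF K(1)] False, of x]
          infdist_nonneg[of x K] by linarith
      moreover have "(\<lambda>n. \<epsilon> / Suc n) \<longlonglongrightarrow> 0"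
        by (rule LIMSEQ_Suc[OF lim_const_over_n])
      ultimately have "\<forall>\<^sub>F n in sequentially. \<epsilon> / Suc n < infdist x K"
        by (rule order_tendstoD(2)[rotated])
      then have "\<forall>\<^sub>F n in sequentially. \<phi> n x = 0"
        by eventually_elim (use supp in force)
      then show ?thesis
        using notK tendsto_eventually by auto
    qed
  qed
qed

section \<open>Radon measures\<close>

lemma compact_in_sets_restrict:
  fixes K :: "'a::t2_space set"
  assumes "sets M = sets (restrict_space borel X)" "compact K" "K \<subseteq> X"
  shows "K \<in> sets M"
proof -
  have "K = K \<inter> X" "K \<in> sets borel"
    using assms by (auto intro: borel_compact)
  then show ?thesis
    unfolding assms(1) sets_restrict_space by blast
qed

lemma radon_on_finite_compact:
  fixes K :: "'a::t2_space set"
  assumes "radon_on X M" "compact K" "K \<subseteq> X"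
  shows "K \<in> sets M" "emeasure M K < \<infinity>"
  using assms compact_in_sets_restrict unfolding radon_on_def by blast+

lemma radon_on_space: "radon_on X M \<Longrightarrow> space M = X"
  unfolding radon_on_def using sets_eq_imp_space_eq[of M "restrict_space borel X"]
  by (simp add: space_restrict_space)

lemma radon_on_integrable:
  fixes f :: "'a::t2_space \<Rightarrow> 'b::{banach, second_countable_topology}"
  assumes M: "radon_on X M" and f: "continuous_on X f"
    and K: "compact K" "K \<subseteq> X" and zero: "\<And>x. x \<in> X \<Longrightarrow> x \<notin> K \<Longrightarrow> f x = 0"
  shows "integrable M f"
proof -
  have "bounded (f ` K)"
    using K f by (intro compact_imp_bounded compact_continuous_image) (auto intro: continuous_on_subset)
  then obtain B where B: "\<And>x. x \<in> K \<Longrightarrow> norm (f x) \<le> B"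
    unfolding bounded_iff by blast
  have sets: "sets M = sets (restrict_space borel X)"
    using M by (simp add: radon_on_def)
  show ?thesis
  proof (rule integrableI_bounded_set)
    show "K \<in> sets M" "emeasure M K < \<infinity>"
      using radon_on_finite_compact[OF M K] .
    show "f \<in> borel_measurable M"
      unfolding measurable_cong_sets[OF sets refl]
      using f by (rule borel_measurable_continuous_on_restrict)
    show "AE x in M. x \<in> K \<longrightarrow> norm (f x) \<le> B"
      using B by auto
    show "AE x in M. x \<notin> K \<longrightarrow> f x = 0"
      using zero radon_on_space[OF M] by (intro AE_I2) auto
  qed
qed

lemma radon_on_loc_integrable_1:
  fixes \<Omega> :: "(real^'n) set"
  assumes "radon_on \<Omega> \<sigma>"
  shows "loc_integrable \<Omega> \<sigma> (\<lambda>_. 1)"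
  unfolding loc_integrable_def set_integrable_def
  using radon_on_finite_compact[OF assms] by (auto intro: integrable_real_indicator)

lemma loc_integrable_lincomb:
  fixes f :: "'q \<Rightarrow> real^'n \<Rightarrow> real"
  assumes "\<And>q. q \<in> I \<Longrightarrow> loc_integrable \<Omega> \<mu> (f q)"
  shows "loc_integrable \<Omega> \<mu> (\<lambda>x. \<Sum>q\<in>I. a q * f q x)"
  using assms unfolding loc_integrable_def set_integrable_def
  by (auto simp: sum_distrib_left mult.left_commute[of _ "a _"] intro!: borel_measurable_sum
      borel_measurable_times Bochner_Integration.integrable_sum integrable_mult_right)

text \<open>Inner regularity is known for finite Borel measures on a complete separable space. It is applied to the
  restrictions of \<open>\<mu>\<close> to the members of a compact exhaustion of \<open>\<Omega>\<close>, transported to the whole space.\<close>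

lemma radon_on_null_if_compact_null:
  fixes \<Omega> :: "'a::euclidean_space set"
  assumes \<Omega>: "open \<Omega>" and \<mu>: "radon_on \<Omega> \<mu>" and E: "E \<in> sets \<mu>"
    and null: "\<And>K. compact K \<Longrightarrow> K \<subseteq> E \<Longrightarrow> emeasure \<mu> K = 0"
  shows "emeasure \<mu> E = 0"
proof -
  have sets: "sets \<mu> = sets (restrict_space borel \<Omega>)"
    using \<mu> by (simp add: radon_on_def)
  have sp: "space \<mu> = \<Omega>" by (rule radon_on_space[OF \<mu>])
  have E\<Omega>: "E \<subseteq> \<Omega>" using sets.sets_into_space[OF E] sp by simp
  have Eb: "E \<in> sets borel"
    using E \<Omega> by (auto simp: sets sets_restrict_space)
  obtain C where C: "\<And>n::nat. compact (C n)" "\<And>n. C n \<subseteq> \<Omega>" "\<Union>(range C) = \<Omega>"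
    using open_Union_compact_subsets[OF \<Omega>] by metis
  have CE: "emeasure \<mu> (C n \<inter> E) = 0" for n
  proof -
    have Cn: "C n \<in> sets \<mu>" "emeasure \<mu> (C n) < \<infinity>"
      using radon_on_finite_compact[OF \<mu> C(1,2)] by auto
    have id: "(\<lambda>x. x) \<in> density \<mu> (indicator (C n)) \<rightarrow>\<^sub>M borel"
      by (simp add: measurable_cong_sets[OF sets refl] measurable_restrict_space1)
    define M where "M = distr (density \<mu> (indicator (C n))) borel (\<lambda>x. x)"
    have M: "emeasure M B = emeasure \<mu> (C n \<inter> B)" if "B \<in> sets borel" for B
    proof -
      have "B \<inter> \<Omega> \<in> sets \<mu>"
        using that by (auto simp: sets sets_restrict_space)
      moreover have "C n \<inter> (B \<inter> \<Omega>) = C n \<inter> B" using C(2) by blast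
      ultimately have "C n \<inter> B \<in> sets \<mu>"
        using Cn(1) by (metis sets.Int)
      with \<open>B \<inter> \<Omega> \<in> sets \<mu>\<close> \<open>C n \<inter> (B \<inter> \<Omega>) = C n \<inter> B\<close> show ?thesis
        using that Cn(1) by (simp add: M_def emeasure_distr[OF id] sp emeasure_density flip: indicator_inter_arith)
    qed
    have "emeasure M (space M) \<noteq> \<infinity>"
      using M[of UNIV] Cn(2) by (simp add: M_def)
    then have "emeasure M E = (SUP K \<in> {K. K \<subseteq> E \<and> compact K}. emeasure M K)"
      using Eb by (intro inner_regular) (auto simp: M_def)
    also have "\<dots> = (SUP K \<in> {K. K \<subseteq> E \<and> compact K}. 0)"
    proof (rule SUP_cong[OF refl])
      fix K assume "K \<in> {K. K \<subseteq> E \<and> compact K}"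
      then have K: "compact K" "K \<subseteq> E" by auto
      have "emeasure M K = emeasure \<mu> (C n \<inter> K)" using K(1) by (intro M borel_compact)
      also have "\<dots> = 0"
        using K C(1) by (intro null compact_Int) auto
      finally show "emeasure M K = 0" .
    qed
    also have "\<dots> = 0" by (simp add: SUP_constant bot_ennreal)
    finally show ?thesis using M[OF Eb] by simp
  qed
  have "E = (\<Union>n. C n \<inter> E)" using C(3) E\<Omega> by blast
  moreover have "emeasure \<mu> (\<Union>n. C n \<inter> E) = 0"
    using CE radon_on_finite_compact(1)[OF \<mu> C(1,2)] E
    by (intro emeasure_UN_eq_0) auto
  ultimately show ?thesis by simp
qed

section \<open>Uniqueness of Lebesgue densities\<close>

lemma integral_cutoff_tendsto:
  fixes f :: "real^'n \<Rightarrow> real" and \<phi> :: "nat \<Rightarrow> real^'n \<Rightarrow> real"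
  assumes sets: "sets \<mu> = sets (restrict_space borel \<Omega>)" and f: "loc_integrable \<Omega> \<mu> f"
    and L: "compact L" "L \<subseteq> \<Omega>" and K: "compact K" "K \<subseteq> \<Omega>"
    and \<phi>: "\<And>n. \<phi> n \<in> C1c \<Omega>" "\<And>n x. \<bar>\<phi> n x\<bar> \<le> indicator L x"
      "\<And>x. (\<lambda>n. \<phi> n x) \<longlonglongrightarrow> indicator K x"
  shows "(\<lambda>n. \<integral>x. \<phi> n x * f x \<partial>\<mu>) \<longlonglongrightarrow> (\<integral>x. indicator K x * f x \<partial>\<mu>)"
proof (rule integral_dominated_convergence[where w="\<lambda>x. \<bar>indicator L x * f x\<bar>"])
  have fm [measurable]: "f \<in> borel_measurable \<mu>"
    using f by (simp add: loc_integrable_def)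
  have [measurable]: "K \<in> sets \<mu>"
    using compact_in_sets_restrict[OF sets K] .
  show "(\<lambda>x. indicator K x * f x) \<in> borel_measurable \<mu>" by measurable
  have [measurable]: "\<phi> n \<in> borel_measurable \<mu>" for n
    unfolding measurable_cong_sets[OF sets refl]
    by (intro measurable_restrict_space1 borel_measurable_continuous_onI C1c_continuous[OF \<phi>(1)])
  show "(\<lambda>x. \<phi> n x * f x) \<in> borel_measurable \<mu>" for n by measurable
  show "integrable \<mu> (\<lambda>x. \<bar>indicator L x * f x\<bar>)"
    using f L by (auto simp: loc_integrable_def set_integrable_def)
  show "AE x in \<mu>. (\<lambda>n. \<phi> n x * f x) \<longlonglongrightarrow> indicator K x * f x"
    by (intro AE_I2 tendsto_mult \<phi>(3) tendsto_const)
  show "AE x in \<mu>. norm (\<phi> n x * f x) \<le> \<bar>indicator L x * f x\<bar>" for n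
    using \<phi>(2)[of n] by (intro AE_I2) (simp add: abs_mult mult_right_mono)
qed

text \<open>A compact subset of \<open>{F > 0} - N\<close> carries a positive integrand with integral zero, so it is
  null; by inner regularity \<open>{F > 0} - N\<close> is null.\<close>

lemma AE_nonpos_if_compact_integrals_0:
  fixes F :: "real^'n \<Rightarrow> real"
  assumes \<Omega>: "open \<Omega>" and \<mu>: "radon_on \<Omega> \<mu>" and F: "loc_integrable \<Omega> \<mu> F"
    and N: "N \<in> sets \<mu>" "emeasure \<mu> N = 0"
    and int: "\<And>K. compact K \<Longrightarrow> K \<subseteq> \<Omega> - N \<Longrightarrow> (\<integral>x. indicator K x * F x \<partial>\<mu>) = 0"
  shows "AE x in \<mu>. F x \<le> 0"
proof -
  have sp: "space \<mu> = \<Omega>" by (rule radon_on_space[OF \<mu>])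
  have [measurable]: "F \<in> borel_measurable \<mu>"
    using F by (simp add: loc_integrable_def)
  define E where "E = {x\<in>space \<mu>. 0 < F x} - N"
  have E: "E \<in> sets \<mu>"
    unfolding E_def using N(1) by measurable
  have "emeasure \<mu> E = 0"
  proof (rule radon_on_null_if_compact_null[OF \<Omega> \<mu> E])
    fix K assume K: "compact K" "K \<subseteq> E"
    then have K\<Omega>: "K \<subseteq> \<Omega> - N" unfolding E_def sp by blast
    have "integrable \<mu> (\<lambda>x. indicator K x * F x)"
      using F K K\<Omega> unfolding loc_integrable_def set_integrable_def by auto
    moreover have "AE x in \<mu>. 0 \<le> indicator K x * F x"
      using K by (intro AE_I2) (auto simp: E_def indicator_def)
    ultimately have "AE x in \<mu>. indicator K x * F x = 0"
      using int[OF K(1) K\<Omega>] integral_nonneg_eq_0_iff_AE by blast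
    then have "AE x in \<mu>. x \<notin> K"
    proof (rule AE_mp, intro AE_I2 impI notI)
      fix x assume "indicator K x * F x = 0" "x \<in> K"
      then show False using K(2) by (auto simp: E_def)
    qed
    moreover have "K \<in> sets \<mu>"
      using radon_on_finite_compact(1)[OF \<mu> K(1)] K\<Omega> by blast
    ultimately show "emeasure \<mu> K = 0"
      using AE_iff_null_sets by blast
  qed
  then have "AE x in \<mu>. x \<notin> E" "AE x in \<mu>. x \<notin> N"
    using AE_iff_null_sets[of E] AE_iff_null_sets[of N] E N by blast+
  then show ?thesis
    by (rule AE_mp[OF _ AE_mp]) (auto simp: E_def intro!: AE_I2)
qed

text \<open>The union of the finitely many null sets that carry the \<open>\<sigma> s\<close> is one null set carrying all of
  them.\<close>

lemma mutually_singular_family: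
  assumes "finite I" and sing: "\<And>s. s \<in> I \<Longrightarrow> mutually_singular \<mu> (\<sigma> s)"
    and sets: "\<And>s. s \<in> I \<Longrightarrow> sets (\<sigma> s) = sets \<mu>"
  obtains N where "N \<in> sets \<mu>" "emeasure \<mu> N = 0"
    "\<And>s. s \<in> I \<Longrightarrow> emeasure (\<sigma> s) (space \<mu> - N) = 0"
proof -
  obtain A where A: "\<And>s. s \<in> I \<Longrightarrow> A s \<in> sets \<mu>" "\<And>s. s \<in> I \<Longrightarrow> emeasure \<mu> (A s) = 0"
      "\<And>s. s \<in> I \<Longrightarrow> emeasure (\<sigma> s) (space (\<sigma> s) - A s) = 0"
    using sing unfolding mutually_singular_def by (metis IntD1)
  show thesis
  proof (rule that[of "\<Union>s\<in>I. A s"])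
    show "(\<Union>s\<in>I. A s) \<in> sets \<mu>" using A(1) \<open>finite I\<close> by blast
    have "(\<Union>s\<in>I. A s) \<in> null_sets \<mu>"
      using A \<open>finite I\<close> by (intro null_sets.finite_UN) auto
    then show "emeasure \<mu> (\<Union>s\<in>I. A s) = 0" by auto
    fix s assume s: "s \<in> I"
    have "emeasure (\<sigma> s) (space \<mu> - (\<Union>s\<in>I. A s)) \<le> emeasure (\<sigma> s) (space (\<sigma> s) - A s)"
      using s A(1)[OF s] sets[OF s] sets_eq_imp_space_eq[OF sets[OF s]]
      by (intro emeasure_mono) auto
    then show "emeasure (\<sigma> s) (space \<mu> - (\<Union>s\<in>I. A s)) = 0"
      using A(3)[OF s] by simp
  qed
qed

text \<open>Uniqueness of Lebesgue decompositions at the level of distributions. Let \<open>N\<close> be a \<open>\<mu>\<close>-null set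
  carrying all singular parts, and \<open>K\<close> a compact set avoiding it. Testing the relation with cutoffs
  converging to the indicator of \<open>K\<close> removes the singular parts in the limit, so that the combined
  density has integral zero over \<open>K\<close>. The singular parts stay a finite family throughout, since the
  difference of two infinite measures makes no sense.\<close>

lemma lebesgue_density_lincomb_eq_0:
  fixes f :: "'q \<Rightarrow> real^'n \<Rightarrow> real"
  assumes \<Omega>: "open \<Omega>" and \<mu>: "radon_on \<Omega> \<mu>" and I: "finite I"
    and dens: "\<And>q. q \<in> I \<Longrightarrow> lebesgue_density \<Omega> \<mu> (T q) (f q)"
    and zero: "\<And>\<phi>. \<phi> \<in> C1c \<Omega> \<Longrightarrow> (\<Sum>q\<in>I. a q * T q \<phi>) = 0"
  shows "AE x in \<mu>. (\<Sum>q\<in>I. a q * f q x) = 0"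
proof -
  define dec where "dec q \<sigma> \<tau> \<longleftrightarrow> radon_on \<Omega> \<sigma> \<and> radon_on \<Omega> \<tau> \<and>
      mutually_singular \<mu> \<sigma> \<and> mutually_singular \<mu> \<tau> \<and>
      (\<forall>\<phi>\<in>C1c \<Omega>. T q \<phi> = (\<integral>x. \<phi> x * f q x \<partial>\<mu>) + ((\<integral>x. \<phi> x \<partial>\<sigma>) - (\<integral>x. \<phi> x \<partial>\<tau>)))"
    for q \<sigma> \<tau>
  have f: "loc_integrable \<Omega> \<mu> (f q)" if "q \<in> I" for q
    using dens[OF that] by (simp add: lebesgue_density_def)
  have "\<exists>\<sigma> \<tau>. dec q \<sigma> \<tau>" if "q \<in> I" for q
    using dens[OF that] by (simp add: lebesgue_density_def dec_def)
  then obtain \<sigma> \<tau> where dec: "\<And>q. q \<in> I \<Longrightarrow> dec q (\<sigma> q) (\<tau> q)"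
    by metis
  have rad: "radon_on \<Omega> (\<sigma> q)" "radon_on \<Omega> (\<tau> q)"
    and sing: "mutually_singular \<mu> (\<sigma> q)" "mutually_singular \<mu> (\<tau> q)" if "q \<in> I" for q
    using dec[OF that] by (simp_all add: dec_def)
  have T: "T q \<phi> = (\<integral>x. \<phi> x * f q x \<partial>\<mu>) + ((\<integral>x. \<phi> x \<partial>\<sigma> q) - (\<integral>x. \<phi> x \<partial>\<tau> q))"
    if "q \<in> I" "\<phi> \<in> C1c \<Omega>" for q \<phi>
    using dec[OF that(1)] that(2) by (simp add: dec_def)
  have sets: "sets \<mu> = sets (restrict_space borel \<Omega>)"
    "\<And>q. q \<in> I \<Longrightarrow> sets (\<sigma> q) = sets (restrict_space borel \<Omega>)"
    "\<And>q. q \<in> I \<Longrightarrow> sets (\<tau> q) = sets (restrict_space borel \<Omega>)"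
    using \<mu> rad by (auto simp: radon_on_def)
  obtain N1 where N1: "N1 \<in> sets \<mu>" "emeasure \<mu> N1 = 0"
      "\<And>q. q \<in> I \<Longrightarrow> emeasure (\<sigma> q) (space \<mu> - N1) = 0"
    using mutually_singular_family[OF I, of \<mu> \<sigma>] sing(1) sets by metis
  obtain N2 where N2: "N2 \<in> sets \<mu>" "emeasure \<mu> N2 = 0"
      "\<And>q. q \<in> I \<Longrightarrow> emeasure (\<tau> q) (space \<mu> - N2) = 0"
    using mutually_singular_family[OF I, of \<mu> \<tau>] sing(2) sets by metis
  define N where "N = N1 \<union> N2"
  have N: "N \<in> sets \<mu>" "emeasure \<mu> N = 0"
    using N1 N2 emeasure_Un_null_set[of N1 \<mu> N2] by (auto simp: N_def null_setsI)
  define F where "F x = (\<Sum>q\<in>I. a q * f q x)" for x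
  have F: "loc_integrable \<Omega> \<mu> F"
    unfolding F_def by (rule loc_integrable_lincomb[OF f])
  have sp: "space \<mu> = \<Omega>" by (rule radon_on_space[OF \<mu>])
  have null: "(\<integral>x. indicator K x * F x \<partial>\<mu>) = 0" if K: "compact K" "K \<subseteq> \<Omega> - N" for K
  proof -
    have K\<Omega>: "K \<subseteq> \<Omega>" using K by blast
    obtain \<phi> L where \<phi>L: "compact L" "L \<subseteq> \<Omega>" and \<phi>: "\<And>n::nat. \<phi> n \<in> C1c \<Omega>"
        "\<And>n x. \<bar>\<phi> n x\<bar> \<le> indicator L x" "\<And>x. (\<lambda>n. \<phi> n x) \<longlonglongrightarrow> indicator K x"
      using C1c_approx_indicator[OF \<Omega> K(1) K\<Omega>] by metis
    have sing_lim: "(\<lambda>n. \<integral>x. \<phi> n x \<partial>\<rho>) \<longlonglongrightarrow> 0"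
      if \<rho>: "radon_on \<Omega> \<rho>" "emeasure \<rho> (space \<mu> - M) = 0" "M \<in> sets \<mu>" "M \<subseteq> N" for \<rho> M
    proof -
      have \<rho>sets: "sets \<rho> = sets (restrict_space borel \<Omega>)"
        using \<rho>(1) by (simp add: radon_on_def)
      have "space \<mu> - M \<in> sets \<rho>"
        using sets.compl_sets[OF \<rho>(3)] by (simp add: sets(1) \<rho>sets)
      then have "emeasure \<rho> K \<le> emeasure \<rho> (space \<mu> - M)"
        using K \<rho>(4) by (intro emeasure_mono) (auto simp: sp)
      then have "measure \<rho> K = 0" using \<rho>(2) by (simp add: measure_def)
      moreover have "(\<lambda>n. \<integral>x. \<phi> n x * 1 \<partial>\<rho>) \<longlonglongrightarrow> (\<integral>x. indicator K x * 1 \<partial>\<rho>)"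
        by (rule integral_cutoff_tendsto[OF \<rho>sets radon_on_loc_integrable_1[OF \<rho>(1)] \<phi>L K(1) K\<Omega> \<phi>])
      moreover have "K \<inter> space \<rho> = K"
        using K\<Omega> radon_on_space[OF \<rho>(1)] by blast
      ultimately show ?thesis by simp
    qed
    have "(\<lambda>n. \<Sum>q\<in>I. a q * T q (\<phi> n)) \<longlonglongrightarrow>
        (\<Sum>q\<in>I. a q * ((\<integral>x. indicator K x * f q x \<partial>\<mu>) + (0 - 0)))"
    proof (rule tendsto_sum, rule tendsto_mult[OF tendsto_const])
      fix q assume q: "q \<in> I"
      show "(\<lambda>n. T q (\<phi> n)) \<longlonglongrightarrow> (\<integral>x. indicator K x * f q x \<partial>\<mu>) + (0 - 0)"
        unfolding T[OF q \<phi>(1)]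
        by (intro tendsto_add tendsto_diff integral_cutoff_tendsto[OF sets(1) f[OF q] \<phi>L K(1) K\<Omega> \<phi>]
            sing_lim[OF rad(1)[OF q] N1(3)[OF q] N1(1)] sing_lim[OF rad(2)[OF q] N2(3)[OF q] N2(1)])
           (auto simp: N_def)
    qed
    then have "(\<Sum>q\<in>I. a q * (\<integral>x. indicator K x * f q x \<partial>\<mu>)) = 0"
      using zero[OF \<phi>(1)] by (simp add: LIMSEQ_const_iff)
    moreover have "(\<integral>x. indicator K x * F x \<partial>\<mu>) = (\<integral>x. (\<Sum>q\<in>I. a q * (indicator K x * f q x)) \<partial>\<mu>)"
      by (simp add: F_def sum_distrib_left mult.left_commute)
    moreover have "\<dots> = (\<Sum>q\<in>I. a q * (\<integral>x. indicator K x * f q x \<partial>\<mu>))"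
      using f K(1) K\<Omega> unfolding loc_integrable_def set_integrable_def
      by (subst Bochner_Integration.integral_sum) auto
    ultimately show ?thesis by simp
  qed
  have "AE x in \<mu>. F x \<le> 0"
    by (rule AE_nonpos_if_compact_integrals_0[OF \<Omega> \<mu> F N null])
  moreover have "AE x in \<mu>. - F x \<le> 0"
  proof (rule AE_nonpos_if_compact_integrals_0[OF \<Omega> \<mu> _ N])
    show "loc_integrable \<Omega> \<mu> (\<lambda>x. - F x)"
      using F unfolding loc_integrable_def set_integrable_def by auto
    show "(\<integral>x. indicator K x * - F x \<partial>\<mu>) = 0" if "compact K" "K \<subseteq> \<Omega> - N" for K
      using null[OF that] by simp
  qed
  ultimately have "AE x in \<mu>. F x = 0"
    by (rule AE_mp[OF _ AE_mp]) (auto intro!: AE_I2)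
  then show ?thesis by (simp add: F_def)
qed

text \<open>The value \<^const>\<open>None\<close> of the option type indexes the distribution on the right-hand side, which
  enters the vanishing combination with coefficient \<open>- a\<close>.\<close>

lemma lebesgue_density_sum_eq:
  fixes f :: "'q::finite \<Rightarrow> real^'n \<Rightarrow> real"
  assumes \<Omega>: "open \<Omega>" and \<mu>: "radon_on \<Omega> \<mu>"
    and T: "\<And>q. lebesgue_density \<Omega> \<mu> (T q) (f q)" and U: "lebesgue_density \<Omega> \<mu> U h"
    and sum: "\<And>\<phi>. \<phi> \<in> C1c \<Omega> \<Longrightarrow> (\<Sum>q\<in>UNIV. T q \<phi>) = a * U \<phi>"
  shows "AE x in \<mu>. (\<Sum>q\<in>UNIV. f q x) = a * h x"
proof -
  have "AE x in \<mu>. (\<Sum>q\<in>UNIV. case_option (- a) (\<lambda>_. 1) q * case_option h f q x) = 0"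
  proof (rule lebesgue_density_lincomb_eq_0[OF \<Omega> \<mu>])
    show "lebesgue_density \<Omega> \<mu> (case_option U T q) (case_option h f q)" for q
      by (cases q) (auto intro: T U)
    show "(\<Sum>q\<in>UNIV. case_option (- a) (\<lambda>_. 1) q * case_option U T q \<phi>) = 0" if "\<phi> \<in> C1c \<Omega>" for \<phi>
      using sum[OF that] by (simp add: UNIV_option_conv sum.reindex)
  qed simp
  then show ?thesis
    by (simp add: UNIV_option_conv sum.reindex algebra_simps)
qed

section \<open>Traces of the linear variations\<close>

lemma radon_on_mass:
  fixes V :: "((real^'n) \<times> (real^'n^'n)) measure"
  assumes V: "varifold d \<Omega> V"
  shows "radon_on \<Omega> (mass \<Omega> V)"
  unfolding radon_on_def
proof (intro conjI allI impI)
  show sets: "sets (mass \<Omega> V) = sets (restrict_space borel \<Omega>)"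
    by (simp add: mass_def)
  fix K assume K: "compact K \<and> K \<subseteq> \<Omega>"
  then have "emeasure (mass \<Omega> V) K = emeasure V (K \<times> grassmannian d)"
    using compact_in_sets_restrict[of "restrict_space borel \<Omega>" \<Omega> K] by (intro emeasure_mass[OF V]) auto
  also have "\<dots> < \<infinity>"
    using V K unfolding varifold_def
    by (intro radon_on_finite_compact(2)) (auto intro!: compact_Times compact_grassmannian)
  finally show "emeasure (mass \<Omega> V) K < \<infinity>" .
qed

text \<open>The integrand is continuous on \<open>\<Omega> \<times> G\<close> and vanishes off the product of the support of \<open>\<phi>\<close> with
  the compact Grassmannian.\<close>

lemma varifold_test_integrable:
  fixes V :: "((real^'n) \<times> (real^'n^'n)) measure"
    and F :: "real^'n^'n \<Rightarrow> real^'n \<Rightarrow> 'b::{banach, second_countable_topology}"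
  assumes V: "varifold d \<Omega> V" and \<phi>: "\<phi> \<in> C1c \<Omega>"
    and F: "continuous_on UNIV (\<lambda>p. F (snd p) (fst p))" "\<And>S. F S 0 = 0"
  shows "integrable V (\<lambda>p. F (snd p) (grad \<phi> (fst p)))"
proof (rule radon_on_integrable)
  show "radon_on (\<Omega> \<times> grassmannian d) V"
    using V by (simp add: varifold_def)
  define K where "K = closure {x. \<phi> x \<noteq> 0}"
  have K: "compact K" "K \<subseteq> \<Omega>" and g: "continuous_on UNIV (grad \<phi>)"
    using \<phi> by (auto simp: C1c_def K_def)
  show "compact (K \<times> (grassmannian d :: (real^'n^'n) set))"
    using K by (intro compact_Times compact_grassmannian)
  show "K \<times> (grassmannian d :: (real^'n^'n) set) \<subseteq> \<Omega> \<times> grassmannian d"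
    using K by auto
  have "continuous_on UNIV (\<lambda>p::(real^'n) \<times> (real^'n^'n). (grad \<phi> (fst p), snd p))"
    by (intro continuous_intros continuous_on_compose2[OF g]) auto
  then have "continuous_on UNIV (\<lambda>p::(real^'n) \<times> (real^'n^'n). F (snd p) (grad \<phi> (fst p)))"
    using continuous_on_compose2[OF F(1)] by fastforce
  then show "continuous_on (\<Omega> \<times> grassmannian d) (\<lambda>p. F (snd p) (grad \<phi> (fst p)))"
    by (rule continuous_on_subset) simp
  show "F (snd p) (grad \<phi> (fst p)) = 0"
    if "p \<in> \<Omega> \<times> grassmannian d" "p \<notin> K \<times> grassmannian d" for p
  proof -
    have "fst p \<notin> K" using that by (auto simp: mem_Times_iff)
    then show ?thesis
      unfolding K_def by (simp add: grad_eq_0_off_support F(2))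
  qed
qed

text \<open>The first variation is recovered from the linear ones in two ways: contracting the matrix index
  with the gradient index uses \<open>S\<^sup>2 = S\<close>, contracting the two matrix indices uses \<open>tr S = d\<close>.\<close>

lemma
  fixes V :: "((real^'n) \<times> (real^'n^'n)) measure"
  assumes V: "varifold d \<Omega> V" and \<phi>: "\<phi> \<in> C1c \<Omega>"
  shows first_variation_trace_outer:
      "(\<Sum>q\<in>UNIV. linear_variation V q i q \<phi>) = first_variation V \<phi> $ i"
    and first_variation_trace_inner:
      "(\<Sum>q\<in>UNIV. linear_variation V i q q \<phi>) = real d * first_variation V \<phi> $ i"
proof -
  have sp: "space V = \<Omega> \<times> grassmannian d"
    using V unfolding varifold_def by (rule radon_on_space)
  have cont: "continuous_on UNIV (\<lambda>p::(real^'n) \<times> (real^'n^'n). snd p *v fst p)"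
    "continuous_on UNIV (\<lambda>p::(real^'n) \<times> (real^'n^'n). snd p $ j $ k * (snd p *v fst p) $ l)" for j k l
    unfolding matrix_vector_mult_def by (intro continuous_intros)+
  have int: "integrable V (\<lambda>p. snd p $ j $ k * (snd p *v grad \<phi> (fst p)) $ l)" for j k l
    by (rule varifold_test_integrable[OF V \<phi>, where F="\<lambda>S v. S $ j $ k * (S *v v) $ l"])
       (simp_all add: cont)
  have int1: "integrable V (\<lambda>p. snd p *v grad \<phi> (fst p))"
    by (rule varifold_test_integrable[OF V \<phi>, where F="\<lambda>S v. S *v v"])
       (simp_all add: cont)
  have lin: "linear_variation V l j k \<phi> = (\<integral>p. snd p $ j $ k * (snd p *v grad \<phi> (fst p)) $ l \<partial>V)" for j k l
    by (simp add: linear_variation_def case_prod_unfold inner_axis)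
  have first: "first_variation V \<phi> $ i = (\<integral>p. (snd p *v grad \<phi> (fst p)) $ i \<partial>V)"
    unfolding first_variation_def case_prod_unfold
    by (rule integral_bounded_linear[symmetric, OF bounded_linear_vec_nth int1])
  have "(\<Sum>q\<in>UNIV. linear_variation V q i q \<phi>)
      = (\<integral>p. (\<Sum>q\<in>UNIV. snd p $ i $ q * (snd p *v grad \<phi> (fst p)) $ q) \<partial>V)"
    unfolding lin by (rule Bochner_Integration.integral_sum[symmetric]) (rule int)
  also have "\<dots> = first_variation V \<phi> $ i"
    unfolding first
  proof (rule Bochner_Integration.integral_cong[OF refl])
    fix p assume "p \<in> space V"
    then have idem: "snd p ** snd p = snd p"
      unfolding sp using grassmannian_iff_projector by (metis mem_Times_iff)
    have "(\<Sum>q\<in>UNIV. snd p $ i $ q * (snd p *v grad \<phi> (fst p)) $ q)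
        = (snd p *v (snd p *v grad \<phi> (fst p))) $ i"
      by (subst (2) matrix_vector_mult_def) simp
    then show "(\<Sum>q\<in>UNIV. snd p $ i $ q * (snd p *v grad \<phi> (fst p)) $ q) = (snd p *v grad \<phi> (fst p)) $ i"
      by (simp add: matrix_vector_mul_assoc idem)
  qed
  finally show "(\<Sum>q\<in>UNIV. linear_variation V q i q \<phi>) = first_variation V \<phi> $ i" .
  have "(\<Sum>q\<in>UNIV. linear_variation V i q q \<phi>)
      = (\<integral>p. (\<Sum>q\<in>UNIV. snd p $ q $ q * (snd p *v grad \<phi> (fst p)) $ i) \<partial>V)"
    unfolding lin by (rule Bochner_Integration.integral_sum[symmetric]) (rule int)
  also have "\<dots> = (\<integral>p. real d * (snd p *v grad \<phi> (fst p)) $ i \<partial>V)"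
  proof (rule Bochner_Integration.integral_cong[OF refl])
    fix p assume "p \<in> space V"
    then have "trace (snd p) = real d"
      unfolding sp using grassmannian_iff_projector by (metis mem_Times_iff)
    then show "(\<Sum>q\<in>UNIV. snd p $ q $ q * (snd p *v grad \<phi> (fst p)) $ i)
        = real d * (snd p *v grad \<phi> (fst p)) $ i"
      by (simp add: trace_def flip: sum_distrib_right)
  qed
  also have "\<dots> = real d * first_variation V \<phi> $ i"
    by (simp add: first)
  finally show "(\<Sum>q\<in>UNIV. linear_variation V i q q \<phi>) = real d * first_variation V \<phi> $ i" .
qed

section \<open>Traces of the orthogonal weak second fundamental form\<close>

theorem proposition5p2:
  fixes \<Omega> :: "(real^'n) set"
    and V :: "((real^'n) \<times> (real^'n^'n)) measure"
    and \<nu> :: "real^'n \<Rightarrow> (real^'n^'n) measure"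
    and \<beta> :: "'n \<Rightarrow> 'n \<Rightarrow> 'n \<Rightarrow> real^'n \<Rightarrow> real"
    and H :: "real^'n \<Rightarrow> real^'n"
    and d :: nat
  assumes "1 \<le> d" and "d \<le> CARD('n)"
    and "open \<Omega>"
    and "varifold d \<Omega> V"
    and "bounded_variations \<Omega> V"
    and "disintegration d \<Omega> V \<nu>"
    and "variation_density \<Omega> V \<beta>"
    and "generalized_mean_curvature \<Omega> V H"
  shows "AE x in mass \<Omega> V.
      (\<chi> i. \<Sum>q\<in>UNIV. orth_wsff (mean_proj \<nu>) \<beta> x q i q) = (mat 1 - mean_proj \<nu> x) *v H x \<and>
      (\<chi> i. \<Sum>q\<in>UNIV. orth_wsff (mean_proj \<nu>) \<beta> x i q q) = 0"
proof -
  note V = \<open>varifold d \<Omega> V\<close>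
  note \<mu> = radon_on_mass[OF V]
  have \<beta>: "lebesgue_density \<Omega> (mass \<Omega> V) (linear_variation V i j k) (\<lambda>x. - \<beta> i j k x)" for i j k
    using \<open>variation_density \<Omega> V \<beta>\<close> by (simp add: variation_density_def)
  have H: "lebesgue_density \<Omega> (mass \<Omega> V) (\<lambda>\<phi>. first_variation V \<phi> $ i) (\<lambda>x. - H x $ i)" for i
    using \<open>generalized_mean_curvature \<Omega> V H\<close> by (simp add: generalized_mean_curvature_def)
  have outer: "AE x in mass \<Omega> V. \<forall>i\<in>UNIV. (\<Sum>q\<in>UNIV. - \<beta> q i q x) = 1 * (- H x $ i)"
  proof (rule AE_finite_allI)
    fix i
    show "AE x in mass \<Omega> V. (\<Sum>q\<in>UNIV. - \<beta> q i q x) = 1 * (- H x $ i)"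
      by (rule lebesgue_density_sum_eq[OF \<open>open \<Omega>\<close> \<mu>, where T="\<lambda>q. linear_variation V q i q"
            and U="\<lambda>\<phi>. first_variation V \<phi> $ i", OF \<beta> H])
         (simp add: first_variation_trace_outer[OF V])
  qed simp
  have inner: "AE x in mass \<Omega> V. \<forall>i\<in>UNIV. (\<Sum>q\<in>UNIV. - \<beta> i q q x) = real d * (- H x $ i)"
  proof (rule AE_finite_allI)
    fix i
    show "AE x in mass \<Omega> V. (\<Sum>q\<in>UNIV. - \<beta> i q q x) = real d * (- H x $ i)"
      by (rule lebesgue_density_sum_eq[OF \<open>open \<Omega>\<close> \<mu>, where T="\<lambda>q. linear_variation V i q q"
            and U="\<lambda>\<phi>. first_variation V \<phi> $ i", OF \<beta> H])
         (simp add: first_variation_trace_inner[OF V])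
  qed simp
  have "\<nu> \<in> mass \<Omega> V \<rightarrow>\<^sub>M prob_algebra (restrict_space borel (grassmannian d))"
    using \<open>disintegration d \<Omega> V \<nu>\<close> by (simp add: disintegration_def)
  then have \<nu>: "AE x in mass \<Omega> V. \<nu> x \<in> space (prob_algebra (restrict_space borel (grassmannian d)))"
    by (intro AE_I2) (rule measurable_space)
  show ?thesis
    using outer inner \<nu>
  proof eventually_elim
    case (elim x)
    have tr: "trace (mean_proj \<nu> x) = real d"
      using elim(3) by (rule trace_mean_proj)
    have psd: "0 \<le> v \<bullet> (mean_proj \<nu> x *v v)" for v
      using elim(3) by (rule mean_proj_psd)
    have 1: "(\<Sum>q\<in>UNIV. \<beta> q i q x) = H x $ i" for i
      using elim(1) by (simp add: sum_negf)
    have 2: "(\<Sum>q\<in>UNIV. \<beta> i q q x) = trace (mean_proj \<nu> x) * H x $ i" for i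
      using elim(2) by (simp add: sum_negf tr)
    show ?case
      using orth_wsff_traces[of "mean_proj \<nu>" x \<beta> "H x", OF psd 1 2] by blast
  qed
qed

end
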